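(* Let $V$ be a probability mass function on $\mathbb{Z}_+=\{0,1,2,\dots\}$ with $V(x)>0$ for all $x\in\mathbb{Z}_+$, and let $c>0$. Suppose $V$ is $c$-log-concave, i.e. $\mathcal{E}^{(V)}(x)\ge c$ for all $x\in\mathbb{Z}_+$. Then for every function $f:\mathbb{Z}_+\to(0,\infty)$ with $\sum_{x=0}^\infty V(x)f(x)<\infty$, $$\mathrm{Ent}_V(f)\le \frac1c\sum_{x=0}^\infty V(x)\,f(x+1)\left(\log\left(\frac{f(x+1)}{f(x)}\right)-1+\frac{f(x)}{f(x+1)}\right),$$ and the right-hand side is non-negative.
   Context: For a strictly positive probability mass function $V$ on $\mathbb{Z}_+$, with the convention $V(-1)=0$, define $$\mathcal{E}^{(V)}(x)=\frac{V(x)}{V(x+1)}-\frac{V(x-1)}{V(x)},\qquad x\in\mathbb{Z}_+.$$ For $f:\mathbb{Z}_+\to(0,\infty)$ put $\mu_{V,f}=\sum_{x=0}^\infty V(x)f(x)$ and $$\mathrm{Ent}_V(f)=\sum_{x=0}^\infty V(x)f(x)\log f(x)-\mu_{V,f}\log\mu_{V,f}.$$ When $\mu_{V,f}<\infty$, $\mathrm{Ent}_V(f)$ is well-defined in $[0,\infty]$. Each summand on the right-hand side of the inequality is non-negative, so that side is a well-defined element of $[0,\infty]$. *)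

theory Defs
  imports "HOL-Probability.Probability"
begin

definition \<E> :: "nat pmf \<Rightarrow> nat \<Rightarrow> real" where
  "\<E> V x = pmf V x / pmf V (x + 1) - (if x = 0 then 0 else pmf V (x - 1)) / pmf V x"

definition c_log_concave :: "real \<Rightarrow> nat pmf \<Rightarrow> bool" where
  "c_log_concave c V \<longleftrightarrow> (\<forall>x. c \<le> \<E> V x)"

definition \<mu> :: "nat pmf \<Rightarrow> (nat \<Rightarrow> real) \<Rightarrow> real" where
  "\<mu> V f = (\<Sum>x. pmf V x * f x)"

text \<open>
  The series \<open>\<Sum>x. V x * f x * ln (f x)\<close> may diverge to \<open>\<infinity>\<close>, so it is taken in the extended reals,
  where its value is the limit of the partial sums. The limit exists whenever \<open>f\<close> is positive,
  see \<open>Ent_series_sums\<close> below.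
\<close>

definition Ent :: "nat pmf \<Rightarrow> (nat \<Rightarrow> real) \<Rightarrow> ereal" where
  "Ent V f = (\<Sum>x. ereal (pmf V x * f x * ln (f x))) - ereal (\<mu> V f * ln (\<mu> V f))"

lemma Ent_series_sums:
  fixes V :: "nat pmf" and f :: "nat \<Rightarrow> real"
  assumes pos: "\<And>x. f x > 0"
  defines "S \<equiv> (\<Sum>x. ereal (pmf V x * f x * ln (f x)))"
  shows "(\<lambda>x. ereal (pmf V x * f x * ln (f x))) sums S" and "S \<noteq> -\<infinity>"
proof -
  let ?g = "\<lambda>x. pmf V x * f x * ln (f x)"
  have g0: "0 \<le> ?g x + pmf V x" for x
  proof -
    have "ln (1 / f x) \<le> 1 / f x - 1"
      using pos[of x] by (intro ln_le_minus_one) simp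
    hence "1 - 1 / f x \<le> ln (f x)"
      using pos[of x] by (simp add: ln_div)
    hence "f x * (1 - 1 / f x) \<le> f x * ln (f x)"
      using pos[of x] by (intro mult_left_mono) simp_all
    hence "0 \<le> f x * ln (f x) + 1"
      using pos[of x] by (simp add: algebra_simps)
    hence "0 \<le> pmf V x * (f x * ln (f x) + 1)"
      by (intro mult_nonneg_nonneg) simp_all
    thus ?thesis by (simp add: algebra_simps)
  qed
  define T where "T = (\<Sum>x. ereal (?g x + pmf V x))"
  have T: "(\<lambda>x. ereal (?g x + pmf V x)) sums T"
    unfolding T_def by (intro summable_sums summable_ereal_pos) (use g0 in simp)
  have T0: "0 \<le> T"
    unfolding T_def by (intro suminf_nonneg summable_ereal_pos) (use g0 in simp_all)
  have "(\<lambda>x. pmf V x) sums 1"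
  proof -
    have "(\<lambda>x. measure (measure_pmf V) {x}) sums measure (measure_pmf V) (\<Union>x. {x})"
      by (intro measure_pmf.finite_measure_UNION) (auto simp: disjoint_family_on_def)
    moreover have "(\<Union>x::nat. {x}) = UNIV" by auto
    ultimately show ?thesis by (simp add: pmf.rep_eq)
  qed
  hence V1: "(\<lambda>n. ereal (\<Sum>x<n. pmf V x)) \<longlonglongrightarrow> ereal 1"
    by (simp add: sums_def)
  have "(\<lambda>n. ereal (\<Sum>x<n. ?g x + pmf V x)) \<longlonglongrightarrow> T"
    using T by (simp add: sums_def)
  hence "(\<lambda>n. ereal (\<Sum>x<n. ?g x + pmf V x) - ereal (\<Sum>x<n. pmf V x)) \<longlonglongrightarrow> T - ereal 1"
    by (intro tendsto_diff_ereal_general V1) auto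
  hence s: "(\<lambda>x. ereal (?g x)) sums (T - ereal 1)"
    by (simp add: sums_def sum.distrib)
  hence S: "S = T - ereal 1"
    unfolding S_def by (simp add: sums_iff)
  show "(\<lambda>x. ereal (?g x)) sums S"
    using s S by simp
  show "S \<noteq> -\<infinity>"
    using S T0 by (cases T) auto
qed

end

theory Submission
  imports Defs
begin

text \<open>
  The right-hand side is a sum of Bregman divergences of \<open>u \<mapsto> u ln u\<close>, taken between
  consecutive values of \<open>f\<close>. The inequality is obtained by minimising the difference of its two
  sides and showing with a discrete maximum principle that the only critical points are constants,
  where the difference vanishes.

  Restrict everything to \<open>{0..N}\<close> and fix the total mass \<open>\<Sum>x\<le>N. v x * f x = \<Sum>x\<le>N. v x\<close>.
  Multiply the difference by \<open>c\<close> and add the barrier \<open>- \<epsilon> * (\<Sum>x\<le>N. v x * ln (f x))\<close>. It makes the functional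
  \<open>deficit\<close> positive near the boundary of the simplex (\<open>deficit_pos_near_boundary\<close>), so if
  the functional takes a negative value, then it has a minimiser with positive entries. At a
  minimiser, moving mass between \<open>y\<close> and \<open>y + 1\<close> has zero first-order effect. With the ratios
  \<open>r x = f (x + 1) / f x\<close> this says (\<open>stationary_equation\<close>),
  reading \<open>v (-1)\<close> as 0,

  \<open>v y / v (y + 1) * ln (r y) - v (y - 1) / v y * ln (r (y - 1)) + r y - r (y + 1)
     = c * ln (r y) + \<epsilon> * (1 / f (y + 1) - 1 / f y)\<close>.

  Suppose \<open>r\<close> is largest at \<open>y\<close> and \<open>r y > 1\<close>. Replacing \<open>r (y - 1)\<close> and \<open>r (y + 1)\<close> by \<open>r y\<close>
  does not increase the left-hand side, which is therefore at least
  \<open>(v y / v (y + 1) - v (y - 1) / v y) * ln (r y) \<ge> c * ln (r y)\<close> by log-concavity, while the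
  barrier makes the right-hand side strictly smaller than \<open>c * ln (r y)\<close>. So \<open>r \<le> 1\<close>; at a
  minimum of \<open>r\<close> all signs are reversed, so \<open>r \<ge> 1\<close> (\<open>stationary_imp_constant\<close>). The minimiser
  is thus the constant 1, with \<open>deficit\<close> equal to 0. Letting \<open>\<epsilon> \<rightarrow> 0\<close> and undoing the
  normalisation of the mass gives the inequality on \<open>{0..N}\<close> (\<open>truncated_log_sobolev\<close>), and then
  \<open>N \<rightarrow> \<infinity>\<close>.
\<close>

section \<open>The deficit functional and its derivative\<close>

text \<open>The Bregman divergence of \<open>u \<mapsto> u ln u\<close>.\<close>

definition ent_bregman :: "real \<Rightarrow> real \<Rightarrow> real" where
  "ent_bregman a b = a * ln (a / b) - a + b"

lemma ent_bregman_nonneg: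
  assumes "a > 0" "b > 0"
  shows "0 \<le> ent_bregman a b"
proof -
  have "ln (b / a) \<le> b / a - 1"
    using assms by (intro ln_le_minus_one) simp
  hence "a * ln (b / a) \<le> a * (b / a - 1)"
    using assms by (intro mult_left_mono) simp_all
  moreover have "ln (a / b) = - ln (b / a)"
    using assms by (simp add: ln_div)
  ultimately show ?thesis
    using assms by (simp add: ent_bregman_def algebra_simps)
qed

text \<open>
  \<open>c\<close> times the deficit of the inequality on \<open>{0..N}\<close>, plus the barrier of weight \<open>\<epsilon>\<close>. The term
  with the logarithm of the mean is absent because the functional is only used under
  \<open>\<Sum>x\<le>N. v x * f x = \<Sum>x\<le>N. v x\<close>, where that term is zero.
\<close>
definition deficit :: "real \<Rightarrow> real \<Rightarrow> (nat \<Rightarrow> real) \<Rightarrow> nat \<Rightarrow> (nat \<Rightarrow> real) \<Rightarrow> real" where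
  "deficit c \<epsilon> v N f = (\<Sum>x<N. v x * ent_bregman (f (Suc x)) (f x))
     - c * (\<Sum>x\<le>N. v x * f x * ln (f x)) - \<epsilon> * (\<Sum>x\<le>N. v x * ln (f x))"

text \<open>
  The value 1 from \<open>N\<close> on corresponds to extending \<open>f\<close> beyond \<open>N\<close> as a constant. With it the
  stationarity equation has the same form at the endpoint \<open>y = N - 1\<close> as elsewhere.
\<close>
definition growth_ratio :: "nat \<Rightarrow> (nat \<Rightarrow> real) \<Rightarrow> nat \<Rightarrow> real" where
  "growth_ratio N f x = (if x < N then f (Suc x) / f x else 1)"

lemma deficit_has_derivative:
  assumes f: "\<And>x. x \<le> N \<Longrightarrow> f x > 0"
  shows "((\<lambda>t. deficit c \<epsilon> v N (\<lambda>x. f x + t * d x)) has_real_derivative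
     (\<Sum>x<N. v x * (ln (f (Suc x) / f x) * d (Suc x) + (1 - f (Suc x) / f x) * d x))
     - c * (\<Sum>x\<le>N. v x * ((ln (f x) + 1) * d x)) - \<epsilon> * (\<Sum>x\<le>N. v x * (d x / f x))) (at 0)"
proof -
  have 1: "((\<lambda>t. v x * ent_bregman (f (Suc x) + t * d (Suc x)) (f x + t * d x)) has_real_derivative
     v x * (ln (f (Suc x) / f x) * d (Suc x) + (1 - f (Suc x) / f x) * d x)) (at 0)"
    if "x < N" for x
  proof -
    have "f x > 0" "f (Suc x) > 0" using f that by auto
    then show ?thesis
      unfolding ent_bregman_def
      by (auto intro!: derivative_eq_intros simp: field_simps)
  qed
  have 2: "((\<lambda>t. v x * (f x + t * d x) * ln (f x + t * d x)) has_real_derivative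
     v x * ((ln (f x) + 1) * d x)) (at 0)" if "x \<le> N" for x
    using f[OF that] by (auto intro!: derivative_eq_intros simp: field_simps)
  have 3: "((\<lambda>t. v x * ln (f x + t * d x)) has_real_derivative
     v x * (d x / f x)) (at 0)" if "x \<le> N" for x
    using f[OF that] by (auto intro!: derivative_eq_intros simp: field_simps)
  show ?thesis
    unfolding deficit_def
    by (intro DERIV_diff DERIV_cmult[OF DERIV_sum] DERIV_sum; rule 1 2 3; simp)
qed

text \<open>
  The direction that moves one unit of \<open>v\<close>-mass from \<open>y\<close> to \<open>y + 1\<close>; it keeps
  \<open>\<Sum>x\<le>N. v x * f x\<close> fixed.
\<close>
definition exchange :: "(nat \<Rightarrow> real) \<Rightarrow> nat \<Rightarrow> nat \<Rightarrow> real" where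
  "exchange v y x = (if x = Suc y then 1 / v (Suc y) else 0) + (if x = y then - 1 / v y else 0)"

lemma sum_exchange:
  assumes "y < N" "\<And>x. v x > 0"
  shows "(\<Sum>x\<le>N. v x * (h x * exchange v y x)) = h (Suc y) - h y"
proof -
  have vn: "v x \<noteq> 0" for x using assms(2)[of x] by simp
  have "(\<Sum>x\<le>N. v x * (h x * exchange v y x))
    = (\<Sum>x\<le>N. (if x = Suc y then h x else 0) + (if x = y then - h x else 0))"
    by (intro sum.cong) (auto simp: exchange_def vn)
  also have "\<dots> = h (Suc y) - h y"
    using assms(1) by (simp add: sum.distrib)
  finally show ?thesis .
qed

text \<open>
  The Lagrange condition for a critical point under the mass constraint. Differentiating along an
  exchange of mass eliminates the multiplier and leaves an equation in the ratios alone, apart from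
  the barrier term.
\<close>
lemma stationary_equation:
  assumes f: "\<And>x. x \<le> N \<Longrightarrow> f x > 0" and v: "\<And>x. v x > 0" and y: "y < N"
    and stat: "((\<lambda>t. deficit c \<epsilon> v N (\<lambda>x. f x + t * exchange v y x)) has_real_derivative 0) (at 0)"
  defines "r \<equiv> growth_ratio N f"
  shows "v y / v (Suc y) * ln (r y) - (if y = 0 then 0 else v (y - 1)) / v y * ln (r (y - 1))
     + r y - r (Suc y) = c * ln (r y) + \<epsilon> * (1 / f (Suc y) - 1 / f y)"
proof -
  let ?d = "exchange v y"
  have vn: "v x \<noteq> 0" for x using v[of x] by simp
  have r: "r x = f (Suc x) / f x" if "x < N" for x
    using that by (simp add: r_def growth_ratio_def)
  have A: "(\<Sum>x\<le>N. v x * ((ln (f x) + 1) * ?d x)) = ln (r y)"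
  proof -
    have "(\<Sum>x\<le>N. v x * ((ln (f x) + 1) * ?d x)) = (ln (f (Suc y)) + 1) - (ln (f y) + 1)"
      by (rule sum_exchange[OF y v])
    also have "\<dots> = ln (r y)"
      using f[of y] f[of "Suc y"] y by (simp add: r ln_div)
    finally show ?thesis .
  qed
  have B: "(\<Sum>x\<le>N. v x * (?d x / f x)) = 1 / f (Suc y) - 1 / f y"
    using sum_exchange[OF y v, where h = "\<lambda>x. 1 / f x"] by simp
  have C: "(\<Sum>x<N. v x * (ln (f (Suc x) / f x) * ?d (Suc x)))
      = v y / v (Suc y) * ln (r y) - (if y = 0 then 0 else v (y - 1)) / v y * ln (r (y - 1))"
  proof -
    have "(\<Sum>x<N. v x * (ln (f (Suc x) / f x) * ?d (Suc x))) =
       (\<Sum>x<N. (if x = y then v y / v (Suc y) * ln (r y) else 0)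
             + (if Suc x = y then - (v x / v y * ln (r x)) else 0))"
      by (intro sum.cong) (auto simp: exchange_def vn r)
    also have "\<dots> = v y / v (Suc y) * ln (r y) + (\<Sum>x<N. if Suc x = y then - (v x / v y * ln (r x)) else 0)"
      using y by (simp add: sum.distrib)
    also have "(\<Sum>x<N. if Suc x = y then - (v x / v y * ln (r x)) else 0)
       = - ((if y = 0 then 0 else v (y - 1)) / v y * ln (r (y - 1)))"
      using y by (cases y) simp_all
    finally show ?thesis by simp
  qed
  have D: "(\<Sum>x<N. v x * ((1 - f (Suc x) / f x) * ?d x)) = r y - r (Suc y)"
  proof -
    have "(\<Sum>x<N. v x * ((1 - f (Suc x) / f x) * ?d x)) = (\<Sum>x\<le>N. v x * ((1 - r x) * ?d x))"
      by (simp add: lessThan_Suc_atMost[symmetric] r) (simp add: r_def growth_ratio_def)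
    also have "\<dots> = r y - r (Suc y)"
      by (subst sum_exchange[OF y v]) simp
    finally show ?thesis .
  qed
  have "(\<Sum>x<N. v x * (ln (f (Suc x) / f x) * ?d (Suc x) + (1 - f (Suc x) / f x) * ?d x))
     - c * (\<Sum>x\<le>N. v x * ((ln (f x) + 1) * ?d x)) - \<epsilon> * (\<Sum>x\<le>N. v x * (?d x / f x)) = 0"
    by (rule DERIV_unique[OF deficit_has_derivative[OF f] stat])
  thus ?thesis
    unfolding A B distrib_left sum.distrib C D by simp
qed

section \<open>The maximum principle\<close>

text \<open>
  Log-concavity is what lets \<open>c * ln (r y)\<close> be absorbed at an extremum of \<open>r\<close>. The barrier then
  supplies a strict inequality, because \<open>1 / f\<close> decreases exactly where \<open>f\<close> increases.
\<close>
lemma stationary_imp_constant: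
  assumes f: "\<And>x. x \<le> N \<Longrightarrow> f x > 0" and v: "\<And>x. v x > 0"
    and eps: "\<epsilon> > 0"
    and lc: "\<And>x. x < N \<Longrightarrow> c \<le> v x / v (Suc x) - (if x = 0 then 0 else v (x - 1)) / v x"
    and stat: "\<And>y. y < N \<Longrightarrow>
      ((\<lambda>t. deficit c \<epsilon> v N (\<lambda>x. f x + t * exchange v y x)) has_real_derivative 0) (at 0)"
    and x: "x \<le> N"
  shows "f x = f 0"
proof -
  define r where "r = growth_ratio N f"
  have r: "r x = f (Suc x) / f x" if "x < N" for x
    using that by (simp add: r_def growth_ratio_def)
  have r0: "r x > 0" for x
    using f by (auto simp: r_def growth_ratio_def)
  have rN: "r x = 1" if "x \<ge> N" for x
    using that by (simp add: r_def growth_ratio_def)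
  define w where "w y = (if y = 0 then 0 else v (y - 1)) / v y" for y
  have w0: "w y \<ge> 0" for y
    using v[of y] v[of "y - 1"] by (simp add: w_def)
  have eq: "v y / v (Suc y) * ln (r y) - w y * ln (r (y - 1)) + r y - r (Suc y)
     = c * ln (r y) + \<epsilon> * (1 / f (Suc y) - 1 / f y)" if "y < N" for y
    unfolding w_def r_def by (rule stationary_equation[OF f v that stat[OF that]])
  have lc': "c \<le> v y / v (Suc y) - w y" if "y < N" for y
    using lc[OF that] by (simp add: w_def)
  \<comment> \<open>At a maximum with \<open>r y > 1\<close> the left side of \<open>eq\<close> is at least \<open>c * ln (r y)\<close>, the right side less.\<close>
  have le1: "r y \<le> 1" if "\<And>x. r x \<le> r y" for y
  proof (rule ccontr)
    assume "\<not> r y \<le> 1"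
    hence gt: "r y > 1" by simp
    hence yN: "y < N" using rN[of y] by (cases "y < N") auto
    have "f (Suc y) > f y"
      using gt f[of y] yN by (simp add: r field_simps)
    hence "1 / f (Suc y) < 1 / f y"
      using f[of y] yN by (simp add: frac_less2)
    hence "\<epsilon> * (1 / f (Suc y) - 1 / f y) < 0"
      using eps by (simp add: mult_pos_neg)
    moreover have "w y * ln (r (y - 1)) \<le> w y * ln (r y)"
      using that[of "y - 1"] r0 w0 by (intro mult_left_mono) simp_all
    moreover have "c * ln (r y) \<le> (v y / v (Suc y) - w y) * ln (r y)"
      using gt lc'[OF yN] by (intro mult_right_mono) simp_all
    moreover have "r (Suc y) \<le> r y" by (rule that)
    ultimately show False
      using eq[OF yN] by (simp add: left_diff_distrib)
  qed
  \<comment> \<open>Reversed at a minimum: now \<open>ln (r y) < 0\<close>, which also reverses the use of log-concavity.\<close>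
  have ge1: "r y \<ge> 1" if "\<And>x. r x \<ge> r y" for y
  proof (rule ccontr)
    assume "\<not> r y \<ge> 1"
    hence lt: "r y < 1" by simp
    hence yN: "y < N" using rN[of y] by (cases "y < N") auto
    have "f (Suc y) < f y"
      using lt f[of y] yN by (simp add: r field_simps)
    hence "1 / f (Suc y) > 1 / f y"
      using f[of "Suc y"] yN by (simp add: frac_less2)
    hence "\<epsilon> * (1 / f (Suc y) - 1 / f y) > 0"
      using eps by simp
    moreover have "w y * ln (r (y - 1)) \<ge> w y * ln (r y)"
      using that[of "y - 1"] r0 w0 by (intro mult_left_mono) simp_all
    moreover have "c * ln (r y) \<ge> (v y / v (Suc y) - w y) * ln (r y)"
      using lt r0[of y] lc'[OF yN] by (intro mult_right_mono_neg) simp_all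
    moreover have "r (Suc y) \<ge> r y" by (rule that)
    ultimately show False
      using eq[OF yN] by (simp add: left_diff_distrib)
  qed
  have "range r \<subseteq> r ` {..N}"
  proof
    fix z assume "z \<in> range r"
    then obtain x where "z = r x" by blast
    thus "z \<in> r ` {..N}"
      using rN[of x] rN[of N] by (cases "x \<le> N") auto
  qed
  hence fin: "finite (range r)"
    by (rule finite_subset) simp
  obtain a where a: "r a = Max (range r)"
    using Max_in[OF fin] by auto
  obtain b where b: "r b = Min (range r)"
    using Min_in[OF fin] by auto
  have "r a \<le> 1" by (rule le1) (simp add: a fin)
  moreover have "r b \<ge> 1" by (rule ge1) (simp add: b fin)
  moreover have "r z \<le> r a" "r b \<le> r z" for z
    by (simp_all add: a b fin)
  ultimately have one: "r z = 1" for z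
    by (meson order.antisym order.trans)
  from x show ?thesis
  proof (induction x)
    case (Suc x)
    thus ?case using one[of x] f[of x] by (simp add: r field_simps)
  qed simp
qed

section \<open>Existence of a minimiser\<close>

lemma deficit_continuous:
  assumes "\<And>f x. f \<in> K \<Longrightarrow> x \<le> N \<Longrightarrow> f x > 0"
  shows "continuous_on K (deficit c \<epsilon> v N)"
proof -
  have coord: "continuous_on K (\<lambda>f :: nat \<Rightarrow> real. f x)" for x
    by (rule continuous_on_product_coordinates[THEN continuous_on_subset]) simp
  have nz: "f x \<noteq> 0" if "f \<in> K" "x \<le> N" for f x
    using assms[OF that] by simp
  show ?thesis
    unfolding deficit_def ent_bregman_def
    by (intro continuous_intros coord) (use nz in \<open>auto simp: Suc_le_eq less_imp_le\<close>)
qed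

text \<open>
  The divergences are non-negative and the entropy is bounded on the simplex, so a sufficiently
  small entry, which makes the barrier large, forces the functional to be positive.
\<close>
lemma deficit_pos_near_boundary:
  assumes f: "\<And>x. x \<le> N \<Longrightarrow> f x > 0" and v: "\<And>x. v x > 0"
    and c: "c > 0" and eps: "\<epsilon> > 0"
    and m: "(\<Sum>x\<le>N. v x * f x) = A" and A: "A = (\<Sum>x\<le>N. v x)"
    and B: "\<And>x. x \<le> N \<Longrightarrow> f x \<le> B" and B1: "B \<ge> 1"
    and y: "y \<le> N"
    and small: "\<epsilon> * v y * ln (f y) < - (c + \<epsilon>) * A * ln B"
  shows "deficit c \<epsilon> v N f > 0"
proof -
  have D: "0 \<le> (\<Sum>x<N. v x * ent_bregman (f (Suc x)) (f x))"
    by (intro sum_nonneg mult_nonneg_nonneg ent_bregman_nonneg less_imp_le[OF v]) (auto intro: f)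
  have lnB: "ln (f x) \<le> ln B" if "x \<le> N" for x
    using f[OF that] B[OF that] by simp
  have "(\<Sum>x\<le>N. v x * f x * ln (f x)) \<le> (\<Sum>x\<le>N. v x * f x * ln B)"
    using f lnB v by (intro sum_mono mult_left_mono mult_nonneg_nonneg) (auto intro: less_imp_le)
  also have "\<dots> = A * ln B"
    by (simp add: sum_distrib_right[symmetric] m)
  finally have E: "c * (\<Sum>x\<le>N. v x * f x * ln (f x)) \<le> c * (A * ln B)"
    using c by simp
  have "(\<Sum>x\<le>N. v x * ln (f x)) = v y * ln (f y) + (\<Sum>x\<in>{..N} - {y}. v x * ln (f x))"
    using y by (intro sum.remove) auto
  also have "(\<Sum>x\<in>{..N} - {y}. v x * ln (f x)) \<le> (\<Sum>x\<in>{..N} - {y}. v x * ln B)"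
    using lnB v by (intro sum_mono mult_left_mono) (auto intro: less_imp_le)
  also have "\<dots> \<le> (\<Sum>x\<le>N. v x * ln B)"
    using B1 v by (intro sum_mono2) (auto intro!: mult_nonneg_nonneg less_imp_le[OF v])
  also have "\<dots> = A * ln B"
    by (simp add: sum_distrib_right[symmetric] A)
  finally have "\<epsilon> * (\<Sum>x\<le>N. v x * ln (f x)) \<le> \<epsilon> * (v y * ln (f y) + A * ln B)"
    using eps by simp
  with D E small show ?thesis
    unfolding deficit_def by (simp add: algebra_simps)
qed

text \<open>
  The minimum is taken over the compact set \<open>K\<close> of functions with the prescribed mass and all
  entries at least \<open>\<delta>\<close>. Since \<open>deficit\<close> is 0 at the constant 1 and positive as soon as an entry
  is at most \<open>\<delta>\<close>, the minimiser stays off the faces of \<open>K\<close>, so exchanges of mass in both directions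
  are admissible, and functions outside \<open>K\<close> satisfy the claim already.
\<close>
lemma deficit_nonneg:
  assumes f: "\<And>x. x \<le> N \<Longrightarrow> f x > 0" and v: "\<And>x. v x > 0"
    and c: "c > 0" and eps: "\<epsilon> > 0"
    and lc: "\<And>x. x < N \<Longrightarrow> c \<le> v x / v (Suc x) - (if x = 0 then 0 else v (x - 1)) / v x"
    and m: "(\<Sum>x\<le>N. v x * f x) = (\<Sum>x\<le>N. v x)"
  shows "deficit c \<epsilon> v N f \<ge> 0"
proof -
  define A where "A = (\<Sum>x\<le>N. v x)"
  define v0 where "v0 = Min (v ` {..N})"
  have v0: "v0 > 0" "\<And>x. x \<le> N \<Longrightarrow> v0 \<le> v x"
    using v by (auto simp: v0_def)
  \<comment> \<open>The mass constraint alone bounds every entry by \<open>B\<close>, so the upper bound in \<open>K\<close> excludes nothing.\<close>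
  define B where "B = A / v0"
  have vA: "v x \<le> A" if "x \<le> N" for x
    unfolding A_def using that by (intro member_le_sum) (auto intro: less_imp_le v)
  have B1: "B \<ge> 1"
    using v0(1) v0(2)[of 0] vA[of 0] by (simp add: B_def)
  have A0: "A > 0" using vA[of 0] v[of 0] by simp
  have upper: "g x \<le> B" if "\<And>x. x \<le> N \<Longrightarrow> g x \<ge> 0" "(\<Sum>x\<le>N. v x * g x) = A" "x \<le> N" for g x
  proof -
    have "v0 * g x \<le> v x * g x"
      using v0 that by (intro mult_right_mono) auto
    also have "\<dots> \<le> A"
      unfolding that(2)[symmetric] using that(1,3) v
      by (intro member_le_sum) (auto intro!: mult_nonneg_nonneg less_imp_le[OF v])
    finally show ?thesis
      using v0(1) by (simp add: B_def field_simps)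
  qed
  \<comment> \<open>Chosen so that \<open>\<epsilon> * v0 * ln \<delta>\<close> is 1 below the threshold of \<open>deficit_pos_near_boundary\<close>.\<close>
  define \<delta> where "\<delta> = exp (- ((c + \<epsilon>) * A * ln B + 1) / (\<epsilon> * v0))"
  have \<delta>0: "\<delta> > 0" by (simp add: \<delta>_def)
  have nn: "(c + \<epsilon>) * A * ln B \<ge> 0"
    using c eps A0 B1 by simp
  have \<delta>1: "\<delta> \<le> 1"
    using nn eps v0(1) by (simp add: \<delta>_def field_simps)
  have bdry: "deficit c \<epsilon> v N g > 0"
    if g: "\<And>x. x \<le> N \<Longrightarrow> g x > 0" and mg: "(\<Sum>x\<le>N. v x * g x) = A"
      and y: "y \<le> N" "g y \<le> \<delta>" for g y
  proof (rule deficit_pos_near_boundary[OF g v c eps mg A_def _ B1 y(1)])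
    show "g x \<le> B" if "x \<le> N" for x
      by (rule upper[OF _ mg that]) (use g in \<open>auto intro: less_imp_le\<close>)
    have ln\<delta>: "ln \<delta> \<le> 0" using \<delta>0 \<delta>1 by simp
    have "ln (g y) \<le> ln \<delta>"
      using g[OF y(1)] y(2) by simp
    hence "\<epsilon> * v y * ln (g y) \<le> \<epsilon> * v y * ln \<delta>"
      using eps v[of y] by (intro mult_left_mono) (auto intro: less_imp_le)
    also have "\<dots> \<le> \<epsilon> * v0 * ln \<delta>"
      using eps v0(2)[OF y(1)] ln\<delta> by (intro mult_right_mono_neg) auto
    also have "\<dots> = - ((c + \<epsilon>) * A * ln B + 1)"
      using eps v0(1) by (simp add: \<delta>_def)
    finally show "\<epsilon> * v y * ln (g y) < - (c + \<epsilon>) * A * ln B"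
      by (simp add: algebra_simps)
  qed (use g in auto)
  \<comment> \<open>Entries beyond \<open>N\<close> are set to 0 to make \<open>K\<close> compact in the product topology.\<close>
  define K where "K = (PiE UNIV (\<lambda>x. if x \<le> N then {\<delta>..B} else {0})) \<inter> {g. (\<Sum>x\<le>N. v x * g x) = A}"
  have Kpos: "g x > 0" if "g \<in> K" "x \<le> N" for g x
  proof -
    have "g x \<in> (if x \<le> N then {\<delta>..B} else {0})"
      using that(1) by (auto simp: K_def PiE_iff)
    thus ?thesis using that(2) \<delta>0 by auto
  qed
  have K_I: "g \<in> K" if "\<And>x. x \<le> N \<Longrightarrow> g x \<ge> \<delta>" "(\<Sum>x\<le>N. v x * g x) = A" "\<And>x. x > N \<Longrightarrow> g x = 0" for g
  proof -
    have "g x \<le> B" if "x \<le> N" for x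
      by (rule upper[OF _ _ that]) (use \<open>\<And>x. x \<le> N \<Longrightarrow> g x \<ge> \<delta>\<close> \<delta>0 \<open>(\<Sum>x\<le>N. v x * g x) = A\<close> in
          \<open>auto intro: order.trans[OF less_imp_le]\<close>)
    with that show ?thesis by (auto simp: K_def PiE_iff)
  qed
  have "compactin (product_topology (\<lambda>_. euclidean) UNIV)
      (PiE UNIV (\<lambda>x :: nat. if x \<le> N then {\<delta>..B} else {0::real}))"
    unfolding compactin_PiE by simp
  hence "compact (PiE UNIV (\<lambda>x. if x \<le> N then {\<delta>..B} else {0::real}))"
    by (simp add: euclidean_product_topology)
  moreover have "closed {g :: nat \<Rightarrow> real. (\<Sum>x\<le>N. v x * g x) = A}"
    by (intro closed_Collect_eq continuous_intros) (rule continuous_on_product_coordinates)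
  ultimately have "compact K"
    unfolding K_def by (rule compact_Int_closed)
  moreover have oneK: "(\<lambda>x. if x \<le> N then 1 else 0) \<in> K"
    by (rule K_I) (use \<delta>1 in \<open>auto simp: A_def\<close>)
  moreover have "continuous_on K (deficit c \<epsilon> v N)"
    by (rule deficit_continuous) (rule Kpos)
  ultimately obtain g where g: "g \<in> K" and gmin: "\<And>h. h \<in> K \<Longrightarrow> deficit c \<epsilon> v N g \<le> deficit c \<epsilon> v N h"
    using continuous_attains_inf[of K "deficit c \<epsilon> v N"] by blast
  have mg: "(\<Sum>x\<le>N. v x * g x) = A" using g by (simp add: K_def)
  have gN: "g x = 0" if "x > N" for x
  proof -
    have "g x \<in> (if x \<le> N then {\<delta>..B} else {0})"
      using g by (auto simp: K_def PiE_iff)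
    thus ?thesis using that by simp
  qed
  have one0: "deficit c \<epsilon> v N (\<lambda>x. if x \<le> N then 1 else 0) = 0"
    by (simp add: deficit_def ent_bregman_def)
  have g\<delta>: "g x > \<delta>" if "x \<le> N" for x
  proof (rule ccontr)
    assume "\<not> g x > \<delta>"
    hence "deficit c \<epsilon> v N g > 0"
      by (intro bdry[OF Kpos[OF g] mg that]) auto
    with gmin[OF oneK] one0 show False by simp
  qed
  have stat: "((\<lambda>t. deficit c \<epsilon> v N (\<lambda>x. g x + t * exchange v y x)) has_real_derivative 0) (at 0)"
    if y: "y < N" for y
  proof -
    let ?h = "\<lambda>t x. g x + t * exchange v y x"
    obtain D where D: "((\<lambda>t. deficit c \<epsilon> v N (?h t)) has_real_derivative D) (at 0)"
      using deficit_has_derivative[of N g c \<epsilon> v "exchange v y"] Kpos[OF g] by blast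
    have "eventually (\<lambda>t. ?h t x > \<delta>) (nhds 0)" if "x \<le> N" for x
    proof -
      have "((\<lambda>t. g x + t * exchange v y x) \<longlongrightarrow> g x + 0 * exchange v y x) (nhds 0)"
        by (intro tendsto_intros filterlim_ident)
      thus ?thesis using g\<delta>[OF that] by (intro order_tendstoD(1)) auto
    qed
    hence "eventually (\<lambda>t. \<forall>x\<in>{..N}. ?h t x > \<delta>) (nhds 0)"
      by (intro eventually_ball_finite) auto
    then obtain e where e: "e > 0" "\<And>t x. \<bar>t\<bar> < e \<Longrightarrow> x \<le> N \<Longrightarrow> ?h t x > \<delta>"
      by (auto simp: eventually_nhds_metric dist_real_def)
    have "?h t \<in> K" if "\<bar>t\<bar> < e" for t
    proof (rule K_I)
      show "?h t x \<ge> \<delta>" if "x \<le> N" for x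
        using e(2)[OF \<open>\<bar>t\<bar> < e\<close> that] by simp
      have "(\<Sum>x\<le>N. v x * ?h t x) = A + t * (\<Sum>x\<le>N. v x * (1 * exchange v y x))"
        by (simp add: algebra_simps sum.distrib sum_distrib_left mg[symmetric])
      thus "(\<Sum>x\<le>N. v x * ?h t x) = A"
        by (subst (asm) sum_exchange[OF y v]) simp
      show "?h t x = 0" if "x > N" for x
        using that y gN by (simp add: exchange_def)
    qed
    hence "D = 0"
      by (intro DERIV_local_min[OF D e(1)]) (use gmin in auto)
    with D show ?thesis by simp
  qed
  have "g x = g 0" if "x \<le> N" for x
    by (rule stationary_imp_constant[OF Kpos[OF g] v eps lc stat that])
  then obtain k where const: "\<And>x. x \<le> N \<Longrightarrow> g x = k"
    by blast
  have "(\<Sum>x\<le>N. v x * g x) = A * k"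
    unfolding A_def sum_distrib_right by (intro sum.cong) (simp_all add: const)
  hence "A = A * k"
    using mg by simp
  hence "k = 1" using A0 by simp
  hence "deficit c \<epsilon> v N g = 0"
    by (simp add: deficit_def ent_bregman_def const)
  hence minK: "deficit c \<epsilon> v N h \<ge> 0" if "h \<in> K" for h
    using gmin[OF that] by simp
  show ?thesis
  proof (cases "\<forall>x\<le>N. f x \<ge> \<delta>")
    case True
    have "(\<lambda>x. if x \<le> N then f x else 0) \<in> K"
      by (rule K_I) (use True m in \<open>auto simp: A_def\<close>)
    from minK[OF this] show ?thesis
      by (simp add: deficit_def)
  next
    case False
    then obtain y where "y \<le> N" "f y \<le> \<delta>" by force
    thus ?thesis
      using bdry[of f y] f m by (auto simp: A_def intro: less_imp_le)
  qed
qed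

section \<open>The inequality on an interval and on the natural numbers\<close>

text \<open>
  Both sides are homogeneous of degree 1 in \<open>f\<close>, so \<open>f\<close> can be rescaled to the mass required by
  \<open>deficit_nonneg\<close>; the term \<open>M * ln (M / (\<Sum>x\<le>N. v x))\<close> is what the rescaling produces. The total
  weight appears in it because truncating a probability mass function leaves less than 1.
\<close>
lemma truncated_log_sobolev:
  assumes f: "\<And>x. x \<le> N \<Longrightarrow> f x > 0" and v: "\<And>x. v x > 0" and c: "c > 0"
    and lc: "\<And>x. x < N \<Longrightarrow> c \<le> v x / v (Suc x) - (if x = 0 then 0 else v (x - 1)) / v x"
  defines "M \<equiv> (\<Sum>x\<le>N. v x * f x)"
  shows "(\<Sum>x\<le>N. v x * f x * ln (f x)) - M * ln (M / (\<Sum>x\<le>N. v x))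
     \<le> (1 / c) * (\<Sum>x<N. v x * ent_bregman (f (Suc x)) (f x))"
proof -
  define A where "A = (\<Sum>x\<le>N. v x)"
  have A0: "A > 0" unfolding A_def by (intro sum_pos v) auto
  have M0: "M > 0" unfolding M_def by (intro sum_pos mult_pos_pos v f) auto
  define s where "s = A / M"
  have s0: "s > 0" using A0 M0 by (simp add: s_def)
  define g where "g x = s * f x" for x
  have g: "g x > 0" if "x \<le> N" for x using f[OF that] s0 by (simp add: g_def)
  have mg: "(\<Sum>x\<le>N. v x * g x) = (\<Sum>x\<le>N. v x)"
  proof -
    have "(\<Sum>x\<le>N. v x * g x) = s * M"
      by (simp add: g_def M_def sum_distrib_left algebra_simps)
    thus ?thesis using M0 by (simp add: s_def A_def)
  qed
  define P where "P = (\<Sum>x<N. v x * ent_bregman (g (Suc x)) (g x)) - c * (\<Sum>x\<le>N. v x * g x * ln (g x))"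
  define Q where "Q = (\<Sum>x\<le>N. v x * ln (g x))"
  \<comment> \<open>Remove the barrier by letting its weight tend to 0.\<close>
  have "P - \<epsilon> * Q \<ge> 0" if "\<epsilon> > 0" for \<epsilon>
    using deficit_nonneg[OF g v c that lc mg] by (simp add: deficit_def P_def Q_def)
  hence ev: "eventually (\<lambda>\<epsilon>. P - \<epsilon> * Q \<ge> 0) (at_right 0)"
    by (auto simp: eventually_at_right_field intro: exI[of _ 1])
  have "((\<lambda>\<epsilon>. P - \<epsilon> * Q) \<longlongrightarrow> P - 0 * Q) (at_right 0)"
    by (intro tendsto_intros)
  hence P0: "P \<ge> 0"
    using tendsto_lowerbound[OF _ ev] by simp
  have D_scale: "(\<Sum>x<N. v x * ent_bregman (g (Suc x)) (g x)) = s * (\<Sum>x<N. v x * ent_bregman (f (Suc x)) (f x))"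
    unfolding sum_distrib_left using s0
    by (intro sum.cong) (auto simp: ent_bregman_def g_def algebra_simps)
  have E_scale: "(\<Sum>x\<le>N. v x * g x * ln (g x)) = s * ((\<Sum>x\<le>N. v x * f x * ln (f x)) - M * ln (M / A))"
  proof -
    have "ln s = - ln (M / A)"
      using A0 M0 by (simp add: s_def ln_div)
    have "(\<Sum>x\<le>N. v x * g x * ln (g x)) = (\<Sum>x\<le>N. s * (v x * f x * ln (f x)) + s * (v x * f x) * ln s)"
      using f s0 by (intro sum.cong) (auto simp: g_def ln_mult algebra_simps)
    also have "\<dots> = s * (\<Sum>x\<le>N. v x * f x * ln (f x)) + s * M * ln s"
      by (simp add: sum.distrib M_def sum_distrib_left sum_distrib_right)
    finally show ?thesis using \<open>ln s = _\<close> by (simp add: algebra_simps)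
  qed
  have "P = s * ((\<Sum>x<N. v x * ent_bregman (f (Suc x)) (f x))
      - c * ((\<Sum>x\<le>N. v x * f x * ln (f x)) - M * ln (M / A)))"
    unfolding P_def D_scale E_scale by (simp only: right_diff_distrib mult.left_commute[of c s])
  hence "0 \<le> s * ((\<Sum>x<N. v x * ent_bregman (f (Suc x)) (f x))
      - c * ((\<Sum>x\<le>N. v x * f x * ln (f x)) - M * ln (M / A)))"
    using P0 by simp
  hence "c * ((\<Sum>x\<le>N. v x * f x * ln (f x)) - M * ln (M / A))
      \<le> (\<Sum>x<N. v x * ent_bregman (f (Suc x)) (f x))"
    using s0 by (simp add: zero_le_mult_iff)
  thus ?thesis
    using c by (simp add: A_def field_simps)
qed

lemma sums_pmf_nat: "pmf (V :: nat pmf) sums 1"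
proof -
  have "(pmf V has_sum infsetsum (pmf V) UNIV) UNIV"
    using pmf_abs_summable[of V UNIV] by (metis abs_summable_equivalent abs_summable_summable has_sum_infsum infsetsum_infsum)
  thus ?thesis
    by (simp add: infsetsum_pmf_eq_1 has_sum_imp_sums)
qed

theorem theorem1p3:
  fixes V :: "nat pmf" and c :: real
  assumes "\<forall>x. pmf V x > 0"
    and "c > 0"
    and "c_log_concave c V"
  shows "\<forall>f :: nat \<Rightarrow> real. (\<forall>x. f x > 0) \<longrightarrow> summable (\<lambda>x. pmf V x * f x) \<longrightarrow>
    (let R = ereal (1 / c) *
           (\<Sum>x. ereal (pmf V x * f (x + 1) * (ln (f (x + 1) / f x) - 1 + f x / f (x + 1))))
     in Ent V f \<le> R \<and> 0 \<le> R)"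
proof (intro allI impI)
  fix f :: "nat \<Rightarrow> real"
  assume f: "\<forall>x. f x > 0" and summ: "summable (\<lambda>x. pmf V x * f x)"
  have V: "pmf V x > 0" for x using assms(1) by simp
  let ?D = "\<lambda>x. pmf V x * f (x + 1) * (ln (f (x + 1) / f x) - 1 + f x / f (x + 1))"
  define T where "T = (\<Sum>x. ereal (?D x))"
  have D: "?D x = pmf V x * ent_bregman (f (Suc x)) (f x)" for x
    using f[rule_format, of "Suc x"] by (simp add: ent_bregman_def field_simps)
  have D0: "0 \<le> ?D x" for x
    unfolding D using f V by (intro mult_nonneg_nonneg ent_bregman_nonneg) auto
  have T0: "0 \<le> T"
    unfolding T_def by (intro suminf_nonneg summable_ereal_pos) (simp_all only: ereal_less_eq(5) D0)
  have partial: "ereal (\<Sum>x<N. ?D x) \<le> T" for N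
  proof -
    have "(\<Sum>x<N. ereal (?D x)) \<le> T"
      unfolding T_def by (intro sum_le_suminf summable_ereal_pos) (simp_all only: ereal_less_eq(5) D0 finite_lessThan)
    thus ?thesis by simp
  qed
  define S where "S = (\<Sum>x. ereal (pmf V x * f x * ln (f x)))"
  let ?m = "\<lambda>N. \<Sum>x\<le>N. pmf V x * f x"
  let ?A = "\<lambda>N. \<Sum>x\<le>N. pmf V x"
  have \<mu>0: "\<mu> V f > 0"
    unfolding \<mu>_def using f V by (intro suminf_pos summ) auto
  have "?m \<longlonglongrightarrow> \<mu> V f"
    unfolding \<mu>_def using summ by (rule summable_LIMSEQ')
  moreover have "?A \<longlonglongrightarrow> 1"
    using sums_pmf_nat[of V] by (simp add: sums_def_le)
  ultimately have "(\<lambda>N. ?m N * ln (?m N / ?A N)) \<longlonglongrightarrow> \<mu> V f * ln (\<mu> V f / 1)"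
    using \<mu>0 by (intro tendsto_intros) auto
  hence mlim: "(\<lambda>N. ereal (?m N * ln (?m N / ?A N))) \<longlonglongrightarrow> ereal (\<mu> V f * ln (\<mu> V f))"
    by simp
  have "(\<lambda>x. ereal (pmf V x * f x * ln (f x))) sums S"
    unfolding S_def using f by (intro Ent_series_sums) auto
  hence "(\<lambda>N. ereal (\<Sum>x\<le>N. pmf V x * f x * ln (f x))) \<longlonglongrightarrow> S"
    by (simp add: sums_def_le)
  from tendsto_diff_ereal_general[OF this mlim]
  have lim: "(\<lambda>N. ereal (\<Sum>x\<le>N. pmf V x * f x * ln (f x)) - ereal (?m N * ln (?m N / ?A N)))
      \<longlonglongrightarrow> Ent V f"
    by (simp add: Ent_def S_def)
  \<comment> \<open>Each truncated entropy is already below the full right-hand side, whose summands are non-negative.\<close>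
  have bound: "ereal (\<Sum>x\<le>N. pmf V x * f x * ln (f x)) - ereal (?m N * ln (?m N / ?A N))
      \<le> ereal (1 / c) * T" for N
  proof -
    have "(\<Sum>x\<le>N. pmf V x * f x * ln (f x)) - ?m N * ln (?m N / ?A N) \<le> (1 / c) * (\<Sum>x<N. ?D x)"
      unfolding D
      by (rule truncated_log_sobolev)
         (use f V assms(2,3) in \<open>simp_all only: c_log_concave_def \<E>_def Suc_eq_plus1\<close>)
    hence "ereal (\<Sum>x\<le>N. pmf V x * f x * ln (f x)) - ereal (?m N * ln (?m N / ?A N))
        \<le> ereal (1 / c) * ereal (\<Sum>x<N. ?D x)"
      by (simp del: One_nat_def)
    also have "\<dots> \<le> ereal (1 / c) * T"
      using assms(2) by (intro ereal_mult_left_mono partial) simp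
    finally show ?thesis .
  qed
  have "Ent V f \<le> ereal (1 / c) * T"
    by (rule LIMSEQ_le_const2[OF lim]) (use bound in auto)
  moreover have "0 \<le> ereal (1 / c) * T"
    using assms(2) T0 by simp
  ultimately show "let R = ereal (1 / c) * (\<Sum>x. ereal (?D x)) in Ent V f \<le> R \<and> 0 \<le> R"
    by (simp only: Let_def T_def)
qed

end
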